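(* Let $X$ be a Hausdorff locally convex topological vector space with dual $X^*$, let $e$ be an error function on $X\times X$, and suppose $f,g:X\to\mathbb{R}\cup\{+\infty\}$ are $e$-convex and $\operatorname{dom} f\cap\operatorname{dom} g\neq\emptyset$. Then the following statements hold (for $y\in X$ and $x^*\in X^*$): (i) $f^*_{e,y}(x^* )\le f^*(x^* )$; hence if $f^*$ is proper, then so is $f^*_{e,y}$; (ii) if $f\le g$, then $g^*_{e,y}(x^* )\le f^*_{e,y}(x^* )$; (iii) if $e'$ is an error function with $e(\cdot,y)\le e'(\cdot,y)$, then $f^*_{e',y}(x^* )\le f^*_{e,y}(x^* )$; (iv) if $h(x):=f(x)+\lambda$ where $\lambda\in\mathbb{R}$, then $h^*_{e,y}(x^* )=f^*_{e,y}(x^* )-\lambda$; (v) if $\lambda>0$ and $h(x):=\lambda f(x)$, then $h^*_{e,y}(x^* )=\lambda f^*_{\frac{e}{\lambda},y}\left(\frac{x^*}{\lambda}\right)$; (vi) if $\lambda>0$, $e$ is positively homogeneous of degree $k>0$ and $h(x):=f(\lambda x)$, then $h^*_{e,y}(x^* )=f^*_{\frac{e}{\lambda^k},\lambda y}\left(\frac{x^*}{\lambda}\right)$; (vii) if $e(\cdot,x)|_{\operatorname{dom} f}$ is locally Lipschitz on $\operatorname{int}(\operatorname{dom} f)$ for each $x\in X$, then $f^*_{e,y}$ is locally Lipschitz on $\operatorname{int}(\operatorname{dom} f)$ as a function of $y$; (viii) $e$-conjugacy is convex, i.e., for every $\lambda\in\,]0,1[$, $$(\lambda f+(1-\lambda)g)^*_{e,y}(x^*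 )\le\lambda f^*_{e,y}(x^* )+(1-\lambda)g^*_{e,y}(x^* );$$ (ix) for every $x\in X$, one has $f^{**}_{e,y}(x)\le f(x)+e(x,y)$; (x) assume that $e(\cdot,w)|_{\operatorname{dom} f}$ is upper semicontinuous for each $w\in\operatorname{dom} f$, and that $e$ is defined on $X\times X$ and has the triangle inequality property, i.e., $e(z,x)\le e(z,y)+e(y,x)$ for all $x,y,z\in X$. Then, for all $x\in\operatorname{dom} f$, $$\partial^{CR}f(x)\ne\emptyset\implies f(x)-e(x,y)\le f^{**}_{e,y}(x).$$
   Context: For an extended-real-valued function $h$, $\operatorname{dom} h=\{h<+\infty\}$, and $h$ is proper if $\operatorname{dom} h\ne\emptyset$. An error function is a map $e:X\times X\to\mathbb{R}\cup\{+\infty\}$ that is nonnegative, symmetric, and has nonempty domain $\operatorname{dom} e=\{(x,y): e(x,y)<+\infty\}$. $f$ is $e$-convex if $\operatorname{dom} f\times\operatorname{dom} f\subset\operatorname{dom} e$ and $f(tx+(1-t)y)\le tf(x)+(1-t)f(y)+t(1-t)e(x,y)$ for all $x,y\in X$, $t\in\,]0,1[$. Convention: $(+\infty)+(-\infty)=(-\infty)+(+\infty)=-\infty$. For fixed $y\in X$, the $(e,y)$-conjugate of $f$ is $f^*_{e,y}(x^* )=\sup_{x\in X}\{\langle x^*,x\rangle-f(x)-e(x,y)\}$ for $x^*\in X^*$, and the $(e,y)$-biconjugate is $f^{**}_{e,y}(x)=\sup_{x^*\in X^*}\{\langle x^*,x\rangle-f^*_{e,y}(x^* )\}$ for $x\in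 X$. The same formulas are used for the other functions and error functions appearing in the statement. Usual conjugate: $f^*(x^* )=\sup_{x\in X}\{\langle x^*,x\rangle-f(x)\}$. "Positively homogeneous of degree $k$" for $e$ means $e(\lambda x,\lambda y)=\lambda^k e(x,y)$ for all $\lambda>0$, $x,y\in X$. Local Lipschitz property: let the topology of $X$ be defined by a family of seminorms $\mathcal{P}$ such that the sets $B(\delta,p_1,\dots,p_n)=\{x\in X:\max_{1\le i\le n}p_i(x)<\delta\}$ ($\delta>0$, $p_1,\dots,p_n\in\mathcal{P}$) form a neighborhood base of the origin. An error function $e$ is Lipschitz near $(x_0,y_0)\in\operatorname{dom} f\times\operatorname{dom} f$ if there is a neighborhood $V=B(\delta,p_1,\dots,p_n)$ of the origin such that $(x_0+V)\times(y_0+V)\subset\operatorname{dom} f\times\operatorname{dom} f$ and $|e(x_1,y_1)-e(x_2,y_2)|\le\max_i p_i(x_1-x_2)+\max_i p_i(y_1-y_2)$ for all $(x_1,y_1),(x_2,y_2)\in(x_0+V)\times(y_0+V)$. Likewise, a function $\varphi$ of one variable is locally Lipschitz on $\operatorname{int}(\operatorname{dom} f)$ if each $x_0\in\operatorname{int}(\operatorname{dom} f)$ has such a $V$ with $x_0+V\subset\operatorname{dom} f$ and $|\varphi(x_1)-\varphi(x_2)|\le\max_i p_i(x_1-x_2)$ for all $x_1,x_2\in x_0+V$. Clarke–Rockafellar generalized directional derivative at $x\in\operatorname{dom} f$ in direction $z$: $f^{\uparrow}(x,z)=\sup_{U}\limsup_{(y,\alpha)\to_f x,\ \lambda\searrow0}\inf_{u\in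 U}\frac{f(y+\lambda u)-\alpha}{\lambda}$, the supremum being over neighborhoods $U$ of $z$, where $(y,\alpha)\to_f x$ means $y\to x$, $\alpha\to f(x)$, $\alpha\ge f(y)$. Clarke–Rockafellar subdifferential: $\partial^{CR}f(x)=\{x^*\in X^*:\langle x^*,z\rangle\le f^{\uparrow}(x,z)\ \forall z\in X\}$ for $x\in\operatorname{dom} f$.
   Formalization: In (vii), false as stated for general seminorm families, either the family of seminorms is assumed finite or the neighborhood V at each point is assumed to serve all x in X; equal infinite values count as being at distance 0 in the Lipschitz condition. *)

theory Defs
  imports "HOL-Analysis.Analysis"
begin

class hausdorff_lcs = real_vector + t2_space + topological_ab_group_add +
  assumes tendsto_scaleR_Pair:
    "LIM z (nhds c \<times>\<^sub>F nhds x). fst z *\<^sub>R snd z :> nhds (c *\<^sub>R x)"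
  and locally_convex:
    "open U \<Longrightarrow> 0 \<in> U \<Longrightarrow> \<exists>C. open C \<and> 0 \<in> C \<and> C \<subseteq> U \<and>
       (\<forall>x\<in>C. \<forall>y\<in>C. \<forall>u\<ge>0. \<forall>v\<ge>0. u + v = 1 \<longrightarrow> u *\<^sub>R x + v *\<^sub>R y \<in> C)"

text \<open>The constant \<^const>\<open>convex\<close> itself cannot be used inside the class specification.\<close>
lemma hausdorff_lcs_convex_nbhd:
  fixes U :: "'a::hausdorff_lcs set"
  assumes "open U" "0 \<in> U"
  shows "\<exists>C. open C \<and> convex C \<and> 0 \<in> C \<and> C \<subseteq> U"
  using locally_convex[OF assms] unfolding convex_def by blast

definition dual :: "('a::hausdorff_lcs \<Rightarrow> real) set" where
  "dual = {xs. linear xs \<and> continuous_on UNIV xs}"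

definition edom :: "('a \<Rightarrow> ereal) \<Rightarrow> 'a set" where
  "edom h = {x. h x < \<infinity>}"

text \<open>
  Functions on the dual space are HOL functions on all of \<open>'a \<Rightarrow> real\<close> whose values off
  \<^const>\<open>dual\<close> are irrelevant, hence the relativisation to a carrier \<open>A\<close>. Proper means only
  that the effective domain is nonempty; the value \<open>-\<infinity>\<close> is not excluded.
\<close>
definition proper_on :: "'a set \<Rightarrow> ('a \<Rightarrow> ereal) \<Rightarrow> bool" where
  "proper_on A h \<longleftrightarrow> A \<inter> edom h \<noteq> {}"

text \<open>
  Addition with the convention \<open>(+\<infinity>) + (-\<infinity>) = (-\<infinity>) + (+\<infinity>) = -\<infinity>\<close>; the library's addition
  on \<^typ>\<open>ereal\<close> gives \<open>\<infinity>\<close> instead. All other extended sums and differences below are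
  determinate (for functions that do not take the value \<open>-\<infinity>\<close>), so there the library
  operations agree with the convention.
\<close>
definition lower_add :: "ereal \<Rightarrow> ereal \<Rightarrow> ereal" where
  "lower_add a b = (if a = -\<infinity> \<or> b = -\<infinity> then -\<infinity> else a + b)"

definition error_function :: "('a \<times> 'a \<Rightarrow> ereal) \<Rightarrow> bool" where
  "error_function e \<longleftrightarrow>
     (\<forall>x y. 0 \<le> e (x, y)) \<and> (\<forall>x y. e (x, y) = e (y, x)) \<and> edom e \<noteq> {}"

definition e_convex :: "('a::real_vector \<times> 'a \<Rightarrow> ereal) \<Rightarrow> ('a \<Rightarrow> ereal) \<Rightarrow> bool" where
  "e_convex e f \<longleftrightarrow>
     edom f \<times> edom f \<subseteq> edom e \<and>
     (\<forall>x y. \<forall>t\<in>{0<..<1}.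
        f (t *\<^sub>R x + (1 - t) *\<^sub>R y)
          \<le> ereal t * f x + ereal (1 - t) * f y + ereal (t * (1 - t)) * e (x, y))"

definition fenchel_conj :: "('a \<Rightarrow> ereal) \<Rightarrow> ('a \<Rightarrow> real) \<Rightarrow> ereal" where
  "fenchel_conj f xs = (SUP x. ereal (xs x) - f x)"

definition e_conj ::
    "('a \<times> 'a \<Rightarrow> ereal) \<Rightarrow> 'a \<Rightarrow> ('a \<Rightarrow> ereal) \<Rightarrow> ('a \<Rightarrow> real) \<Rightarrow> ereal" where
  "e_conj e y f xs = (SUP x. ereal (xs x) - f x - e (x, y))"

definition e_biconj ::
    "('a \<times> 'a \<Rightarrow> ereal) \<Rightarrow> 'a \<Rightarrow> ('a::hausdorff_lcs \<Rightarrow> ereal) \<Rightarrow> 'a \<Rightarrow> ereal" where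
  "e_biconj e y f x = (SUP xs\<in>dual. ereal (xs x) - e_conj e y f xs)"

definition pos_homogeneous :: "real \<Rightarrow> ('a::real_vector \<times> 'a \<Rightarrow> ereal) \<Rightarrow> bool" where
  "pos_homogeneous k e \<longleftrightarrow>
     (\<forall>c>0. \<forall>x y. e (c *\<^sub>R x, c *\<^sub>R y) = ereal (c powr k) * e (x, y))"

definition seminorm :: "('a::real_vector \<Rightarrow> real) \<Rightarrow> bool" where
  "seminorm p \<longleftrightarrow>
     (\<forall>x. 0 \<le> p x) \<and> (\<forall>x y. p (x + y) \<le> p x + p y) \<and> (\<forall>c x. p (c *\<^sub>R x) = \<bar>c\<bar> * p x)"

text \<open>Finitely many seminorms \<open>p\<^sub>1, \<dots>, p\<^sub>n\<close> are given as a finite nonempty set.\<close>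
definition max_seminorm :: "('a \<Rightarrow> real) set \<Rightarrow> 'a \<Rightarrow> real" where
  "max_seminorm ps x = Max ((\<lambda>p. p x) ` ps)"

definition seminorm_ball :: "real \<Rightarrow> ('a \<Rightarrow> real) set \<Rightarrow> 'a set" where
  "seminorm_ball \<delta> ps = {x. max_seminorm ps x < \<delta>}"

definition finite_subfamily :: "('a \<Rightarrow> real) set \<Rightarrow> ('a \<Rightarrow> real) set \<Rightarrow> bool" where
  "finite_subfamily P ps \<longleftrightarrow> finite ps \<and> ps \<noteq> {} \<and> ps \<subseteq> P"

definition defining_seminorms :: "('a::hausdorff_lcs \<Rightarrow> real) set \<Rightarrow> bool" where
  "defining_seminorms P \<longleftrightarrow>
     (\<forall>p\<in>P. seminorm p) \<and>
     (\<forall>\<delta>>0. \<forall>ps. finite_subfamily P ps \<longrightarrow> 0 \<in> interior (seminorm_ball \<delta> ps)) \<and>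
     (\<forall>U. open U \<and> 0 \<in> U \<longrightarrow>
        (\<exists>\<delta>>0. \<exists>ps. finite_subfamily P ps \<and> seminorm_ball \<delta> ps \<subseteq> U))"

text \<open>
  The quantity \<open>\<bar>a - b\<bar>\<close> for extended reals, where two equal infinite values are at distance
  \<open>0\<close>. Without this a conjugate that is constantly \<open>+\<infinity>\<close> in \<open>y\<close> (such as that of \<open>f = 0\<close>,
  \<open>e = 0\<close> at a nonzero functional) would not count as Lipschitz.
\<close>
definition ereal_gap :: "ereal \<Rightarrow> ereal \<Rightarrow> ereal" where
  "ereal_gap a b = (if a = b then 0 else \<bar>a - b\<bar>)"

definition lipschitz_near ::
    "'a::ab_group_add set \<Rightarrow> 'a \<Rightarrow> real \<Rightarrow> ('a \<Rightarrow> real) set \<Rightarrow> ('a \<Rightarrow> ereal) \<Rightarrow> bool" where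
  "lipschitz_near D x0 \<delta> ps \<phi> \<longleftrightarrow>
     (+) x0 ` seminorm_ball \<delta> ps \<subseteq> D \<and>
     (\<forall>x1\<in>(+) x0 ` seminorm_ball \<delta> ps. \<forall>x2\<in>(+) x0 ` seminorm_ball \<delta> ps.
        ereal_gap (\<phi> x1) (\<phi> x2) \<le> ereal (max_seminorm ps (x1 - x2)))"

definition locally_lipschitz ::
    "('a::hausdorff_lcs \<Rightarrow> real) set \<Rightarrow> 'a set \<Rightarrow> ('a \<Rightarrow> ereal) \<Rightarrow> bool" where
  "locally_lipschitz P D \<phi> \<longleftrightarrow>
     (\<forall>x0\<in>interior D. \<exists>\<delta>>0. \<exists>ps. finite_subfamily P ps \<and> lipschitz_near D x0 \<delta> ps \<phi>)"

text \<open>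
  Local Lipschitz continuity for each member of the family \<open>\<Phi>\<close>, the neighbourhood of a point
  being the same for all members. The Lipschitz constant is absorbed in the choice of the
  seminorms, so if \<open>P\<close> is infinite, separate local Lipschitz continuity of the functions
  \<open>e(\<cdot>,x)\<close> bounds nothing uniformly in \<open>x\<close>, and suprema over \<open>x\<close> need not be locally
  Lipschitz: on the real line with \<open>P = {n\<bar>\<cdot>\<bar> | n \<ge> 1}\<close> take \<open>f = 0\<close> and
  \<open>e(x,y) = sqrt (min \<bar>x\<bar> \<bar>y\<bar> + 1/(1 + max \<bar>x\<bar> \<bar>y\<bar>))\<close>, for which the conjugate at the zero
  functional is \<open>- sqrt \<bar>y\<bar>\<close> near \<open>y = 0\<close>. For finite \<open>P\<close> (in particular for a single norm) separate
  local Lipschitz continuity suffices.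
\<close>
definition equi_locally_lipschitz ::
    "('a::hausdorff_lcs \<Rightarrow> real) set \<Rightarrow> 'a set \<Rightarrow> ('a \<Rightarrow> ereal) set \<Rightarrow> bool" where
  "equi_locally_lipschitz P D \<Phi> \<longleftrightarrow>
     (\<forall>x0\<in>interior D. \<exists>\<delta>>0. \<exists>ps. finite_subfamily P ps \<and>
        (\<forall>\<phi>\<in>\<Phi>. lipschitz_near D x0 \<delta> ps \<phi>))"

definition usc_on :: "'a::topological_space set \<Rightarrow> ('a \<Rightarrow> ereal) \<Rightarrow> bool" where
  "usc_on D \<phi> \<longleftrightarrow> (\<forall>x\<in>D. Limsup (at x within D) \<phi> \<le> \<phi> x)"

definition triangle_inequality :: "('a \<times> 'a \<Rightarrow> ereal) \<Rightarrow> bool" where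
  "triangle_inequality e \<longleftrightarrow> (\<forall>x y z. e (z, x) \<le> e (z, y) + e (y, x))"

text \<open>
  The filter of \<open>(y, \<alpha>, \<tau>)\<close> with \<open>y \<rightarrow> x\<close>, \<open>\<alpha> \<rightarrow> f x\<close>, \<open>\<alpha> \<ge> f y\<close> and \<open>\<tau> \<searrow> 0\<close>, for \<open>f x\<close> finite.
\<close>
definition cr_filter ::
    "('a::topological_space \<Rightarrow> ereal) \<Rightarrow> 'a \<Rightarrow> ('a \<times> real \<times> real) filter" where
  "cr_filter f x =
     inf (nhds x \<times>\<^sub>F (nhds (real_of_ereal (f x)) \<times>\<^sub>F at_right 0))
         (principal {(y, \<alpha>, \<tau>). f y \<le> ereal \<alpha>})"

definition cr_derivative :: "('a::hausdorff_lcs \<Rightarrow> ereal) \<Rightarrow> 'a \<Rightarrow> 'a \<Rightarrow> ereal" where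
  "cr_derivative f x z =
     (SUP U\<in>{U. z \<in> interior U}.
        Limsup (cr_filter f x)
          (\<lambda>(y, \<alpha>, \<tau>). INF u\<in>U. (f (y + \<tau> *\<^sub>R u) - ereal \<alpha>) / ereal \<tau>))"

definition cr_subdifferential ::
    "('a::hausdorff_lcs \<Rightarrow> ereal) \<Rightarrow> 'a \<Rightarrow> ('a \<Rightarrow> real) set" where
  "cr_subdifferential f x = {xs \<in> dual. \<forall>z. ereal (xs z) \<le> cr_derivative f x z}"

end

theory Submission
  imports Defs
begin

text \<open>
  For (vii), conjugation in the variable \<open>y\<close> is nonexpansive for the supremum of the gaps
  \<open>\<bar>e(x,y\<^sub>1) - e(x,y\<^sub>2)\<bar>\<close> over \<open>x\<close>, so a bound on these that is uniform in \<open>x\<close> is all that is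
  needed. If \<open>P\<close> is finite, all the Lipschitz constants are dominated by the single seminorm
  \<open>max P\<close>, and a function that is locally \<open>1\<close>-Lipschitz for it is \<open>1\<close>-Lipschitz along segments,
  hence on a ball independent of \<open>x\<close>.

  For (x), testing \<open>f\<^sup>\<up>(x, z - x)\<close> with the directions \<open>u = z - y\<close> (\<open>y \<rightarrow> x\<close>) in the \<open>e\<close>-convexity
  inequality gives \<open>\<langle>x\<^sup>*, z - x\<rangle> \<le> f(z) - f(x) + e(z,x)\<close> for every subgradient \<open>x\<^sup>*\<close>; the triangle
  inequality turns this into \<open>f\<^sup>*\<^sub>e\<^sub>,\<^sub>y(x\<^sup>*) \<le> \<langle>x\<^sup>*, x\<rangle> - f(x) + e(x,y)\<close>.
\<close>

subsection \<open>Calculus of conjugates\<close>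

lemma e_conj_mono:
  assumes "\<And>x. f x \<le> g x" and "\<And>x. e (x, y) \<le> e' (x, y)"
  shows "e_conj e' y g xs \<le> e_conj e y f xs"
  unfolding e_conj_def by (intro SUP_mono' ereal_minus_mono order_refl assms)

text \<open>Viewing the usual conjugate as the case of zero error makes (i) an instance of
  monotonicity in the error.\<close>

lemma e_conj_zero: "e_conj (\<lambda>_. 0) y f = fenchel_conj f"
  by (simp add: e_conj_def fenchel_conj_def fun_eq_iff)

lemma e_conj_upper: "ereal (xs x) - f x - e (x, y) \<le> e_conj e y f xs"
  unfolding e_conj_def by (rule SUP_upper) simp

lemma e_conj_add_const: "e_conj e y (\<lambda>x. f x + ereal l) xs = e_conj e y f xs - ereal l"
proof -
  have "ereal (xs x) - (f x + ereal l) - e (x, y) = ereal (xs x) - f x - e (x, y) + ereal (- l)" for x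
    by (cases "f x"; cases "e (x, y)") auto
  then have "e_conj e y (\<lambda>x. f x + ereal l) xs
      = (SUP x. ereal (xs x) - f x - e (x, y) + ereal (- l))"
    unfolding e_conj_def by presburger
  \<comment> \<open>A finite constant may leave the supremum over a nonempty set, even when that
    supremum is infinite.\<close>
  also have "\<dots> = e_conj e y f xs + ereal (- l)"
    unfolding e_conj_def by (rule SUP_ereal_add_left) auto
  finally show ?thesis
    by (simp add: minus_ereal_def)
qed

text \<open>Dividing each term by \<open>l\<close> puts the factor on the functional and the error;
  being positive, \<open>l\<close> then passes through the supremum.\<close>

lemma e_conj_scale:
  assumes "l > 0"
  shows "e_conj e y (\<lambda>x. ereal l * f x) xs
    = ereal l * e_conj (\<lambda>p. e p / ereal l) y f (\<lambda>x. xs x / l)"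
proof -
  have "ereal (xs x) - ereal l * f x - e (x, y)
      = ereal l * (ereal (xs x / l) - f x - e (x, y) / ereal l)" for x
    using assms by (cases "f x"; cases "e (x, y)") (auto simp: field_simps)
  then have "e_conj e y (\<lambda>x. ereal l * f x) xs
      = (SUP x. ereal l * (ereal (xs x / l) - f x - e (x, y) / ereal l))"
    unfolding e_conj_def by presburger
  also have "\<dots> = ereal l * e_conj (\<lambda>p. e p / ereal l) y f (\<lambda>x. xs x / l)"
    unfolding e_conj_def
    using assms by (intro Sup_ereal_mult_left'[symmetric]) auto
  finally show ?thesis .
qed

text \<open>Substitute \<open>w = l *\<^sub>R x\<close>, a bijection of the space. Homogeneity turns
  the error at the dilated pair, divided by \<open>l powr k\<close>, back into
  \<open>e (x, y)\<close>, and linearity gives \<open>xs w / l = xs x\<close>.\<close>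

lemma e_conj_dilate:
  fixes xs :: "'a::real_vector \<Rightarrow> real"
  assumes "l > 0" and "pos_homogeneous k e" and "linear xs"
  shows "e_conj e y (\<lambda>x. f (l *\<^sub>R x)) xs
    = e_conj (\<lambda>p. e p / ereal (l powr k)) (l *\<^sub>R y) f (\<lambda>x. xs x / l)"
proof -
  let ?F = "\<lambda>w. ereal (xs w / l) - f w - e (w, l *\<^sub>R y) / ereal (l powr k)"
  have "ereal (xs x) - f (l *\<^sub>R x) - e (x, y) = ?F (l *\<^sub>R x)" for x
  proof -
    have "e (l *\<^sub>R x, l *\<^sub>R y) / ereal (l powr k) = e (x, y)"
      using assms(1,2) unfolding pos_homogeneous_def by (cases "e (x, y)") auto
    then show ?thesis
      using assms(1) linear_scale[OF assms(3)] by simp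
  qed
  then have "e_conj e y (\<lambda>x. f (l *\<^sub>R x)) xs = Sup (?F ` range (\<lambda>x. l *\<^sub>R x))"
    unfolding e_conj_def image_image by presburger
  also have "range (\<lambda>x::'a. l *\<^sub>R x) = UNIV"
    using assms(1) by (intro surjI[where f = "\<lambda>x. x /\<^sub>R l"]) simp
  finally show ?thesis
    unfolding e_conj_def by simp
qed

lemma e_conj_convex:
  assumes "l \<in> {0<..<1}" and "\<And>x. f x \<noteq> -\<infinity>" and "\<And>x. g x \<noteq> -\<infinity>" and "\<And>x. 0 \<le> e (x, y)"
  shows "e_conj e y (\<lambda>x. ereal l * f x + ereal (1 - l) * g x) xs
    \<le> lower_add (ereal l * e_conj e y f xs) (ereal (1 - l) * e_conj e y g xs)"
  unfolding e_conj_def[of _ _ "\<lambda>x. ereal l * f x + ereal (1 - l) * g x"]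
proof (rule SUP_least)
  fix x
  \<comment> \<open>Arbitrary bounds \<open>a\<close>, \<open>b\<close> in place of the two
    conjugates permit a case split on their values. An infinite \<open>f x\<close>,
    \<open>g x\<close> or \<open>e (x, y)\<close> makes the left side minus infinity; otherwise
    \<open>a\<close> and \<open>b\<close> exceed minus infinity, so \<open>lower_add\<close> never
    meets opposite infinities.\<close>
  have *: "ereal (xs x) - (ereal l * f x + ereal (1 - l) * g x) - e (x, y)
      \<le> lower_add (ereal l * a) (ereal (1 - l) * b)"
    if a: "ereal (xs x) - f x - e (x, y) \<le> a" and b: "ereal (xs x) - g x - e (x, y) \<le> b" for a b
  proof (cases "f x = \<infinity> \<or> g x = \<infinity> \<or> e (x, y) = \<infinity>")
    case True
    then show ?thesis
      using assms by (cases "f x"; cases "g x"; cases "e (x, y)") auto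
  next
    case False
    then obtain u v w where eq: "f x = ereal u" "g x = ereal v" "e (x, y) = ereal w"
      using assms(2)[of x] assms(3)[of x] assms(4)[of x]
      by (cases "f x"; cases "g x"; cases "e (x, y)") simp_all
    show ?thesis
    proof (cases "a = \<infinity> \<or> b = \<infinity>")
      case True
      then show ?thesis
        using a b eq assms(1) by (cases a; cases b) (auto simp: lower_add_def)
    next
      case False
      then obtain a' b' where ab: "a = ereal a'" "b = ereal b'"
        using a b eq by (cases a; cases b) auto
      have "l * (xs x - u - w) \<le> l * a'" "(1 - l) * (xs x - v - w) \<le> (1 - l) * b'"
        using a b eq ab assms(1) by (auto intro!: mult_left_mono)
      then show ?thesis
        using eq ab by (simp add: lower_add_def algebra_simps)
    qed
  qed
  show "ereal (xs x) - (ereal l * f x + ereal (1 - l) * g x) - e (x, y)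
      \<le> lower_add (ereal l * e_conj e y f xs) (ereal (1 - l) * e_conj e y g xs)"
    by (rule *) (rule e_conj_upper)+
qed

text \<open>The Fenchel-Young inequality, that is, the term at \<open>x\<close> in the supremum
  defining the conjugate, bounds every term of the biconjugate.\<close>

lemma e_biconj_le:
  assumes "f x \<noteq> -\<infinity>" and "0 \<le> e (x, y)"
  shows "e_biconj e y f x \<le> f x + e (x, y)"
  unfolding e_biconj_def
proof (rule SUP_least)
  fix xs
  show "ereal (xs x) - e_conj e y f xs \<le> f x + e (x, y)"
    using e_conj_upper[of xs x f e y] assms
    by (cases "f x"; cases "e (x, y)"; cases "e_conj e y f xs") auto
qed

subsection \<open>Lipschitz dependence on the base point\<close>

text \<open>Two one-sided inequalities avoid differences of infinities and include the case of equal
  infinite values; the estimates below work in this form.\<close>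

lemma ereal_gap_le_iff:
  assumes "0 \<le> d"
  shows "ereal_gap a b \<le> ereal d \<longleftrightarrow> a \<le> b + ereal d \<and> b \<le> a + ereal d"
  using assms by (cases a; cases b) (auto simp: ereal_gap_def)

lemma ereal_gap_e_conj_le:
  assumes "0 \<le> d" and "\<And>x. ereal_gap (e (x, y1)) (e (x, y2)) \<le> ereal d"
  shows "ereal_gap (e_conj e y1 f xs) (e_conj e y2 f xs) \<le> ereal d"
proof -
  \<comment> \<open>The error enters with a minus sign, so the roles of \<open>a\<close> and
    \<open>b\<close> are exchanged. Both instances together give the gap.\<close>
  have *: "e_conj e a f xs \<le> e_conj e b f xs + ereal d"
    if "\<And>x. e (x, b) \<le> e (x, a) + ereal d" for a b
    unfolding e_conj_def[of e a]
  proof (rule SUP_least)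
    fix x
    have "ereal (xs x) - f x - e (x, a) \<le> ereal (xs x) - f x - e (x, b) + ereal d"
      using that[of x] by (cases "f x"; cases "e (x, a)"; cases "e (x, b)") auto
    also have "\<dots> \<le> e_conj e b f xs + ereal d"
      by (intro add_right_mono e_conj_upper)
    finally show "ereal (xs x) - f x - e (x, a) \<le> e_conj e b f xs + ereal d" .
  qed
  show ?thesis
    using assms(2) unfolding ereal_gap_le_iff[OF assms(1)] by (intro conjI * ) auto
qed

section \<open>Finite maxima of seminorms and their balls\<close>

lemma seminorm_max_seminorm:
  assumes fin: "finite ps" and ne: "ps \<noteq> {}" and sn: "\<And>p. p \<in> ps \<Longrightarrow> seminorm p"
  shows "seminorm (max_seminorm ps)"
proof -
  have le: "p x \<le> max_seminorm ps x" if "p \<in> ps" for p x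
    using fin that unfolding max_seminorm_def by auto
  have "0 \<le> max_seminorm ps x" for x
    using ne sn le unfolding seminorm_def by (meson all_not_in_conv order_trans)
  moreover have "max_seminorm ps (x + y) \<le> max_seminorm ps x + max_seminorm ps y" for x y
  proof -
    have "p (x + y) \<le> max_seminorm ps x + max_seminorm ps y" if "p \<in> ps" for p
      using sn[OF that] le[OF that, of x] le[OF that, of y] unfolding seminorm_def
      by (smt (verit))
    then show ?thesis
      using fin ne unfolding max_seminorm_def[of ps "x + y"] by auto
  qed
  moreover have "max_seminorm ps (c *\<^sub>R x) = \<bar>c\<bar> * max_seminorm ps x" for c x
  proof -
    \<comment> \<open>Homogeneity holds because a monotone map commutes with the maximum of a
      nonempty finite set.\<close>
    have "mono ((*) \<bar>c\<bar>)"
      by (auto intro!: monoI mult_left_mono)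
    then have "\<bar>c\<bar> * Max ((\<lambda>p. p x) ` ps) = Max ((*) \<bar>c\<bar> ` (\<lambda>p. p x) ` ps)"
      using fin ne by (intro mono_Max_commute) auto
    also have "(*) \<bar>c\<bar> ` (\<lambda>p. p x) ` ps = (\<lambda>p. p (c *\<^sub>R x)) ` ps"
      using sn unfolding image_image seminorm_def by (intro image_cong) auto
    finally show ?thesis
      unfolding max_seminorm_def by simp
  qed
  ultimately show ?thesis
    unfolding seminorm_def by blast
qed

lemma max_seminorm_mono:
  assumes "finite qs" and "ps \<noteq> {}" and "ps \<subseteq> qs"
  shows "max_seminorm ps x \<le> max_seminorm qs x"
  unfolding max_seminorm_def using assms by (intro Max_mono) auto

lemma seminorm_minus: "seminorm p \<Longrightarrow> p (- x) = p x"
  unfolding seminorm_def by (metis abs_minus abs_one mult_1 scaleR_minus1_left)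

text \<open>Keeps the segment between two points of a ball inside it, as required for chaining
  Lipschitz bounds.\<close>

lemma convex_seminorm_ball_translate:
  assumes "seminorm (max_seminorm ps)"
  shows "convex ((+) x ` seminorm_ball \<delta> ps)"
proof -
  let ?p = "max_seminorm ps"
  have "convex (seminorm_ball \<delta> ps)"
    unfolding convex_def
  proof (intro ballI allI impI)
    fix a b :: 'a and u v :: real
    assume a: "a \<in> seminorm_ball \<delta> ps" and b: "b \<in> seminorm_ball \<delta> ps"
      and uv: "0 \<le> u" "0 \<le> v" "u + v = 1"
    have "?p (u *\<^sub>R a + v *\<^sub>R b) \<le> ?p (u *\<^sub>R a) + ?p (v *\<^sub>R b)"
      using assms unfolding seminorm_def by blast
    also have "\<dots> = u * ?p a + v * ?p b"
      using assms uv unfolding seminorm_def by simp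
    also have "\<dots> < \<delta>"
      using a b uv by (intro convex_bound_lt) (auto simp: seminorm_ball_def)
    finally show "u *\<^sub>R a + v *\<^sub>R b \<in> seminorm_ball \<delta> ps"
      by (simp add: seminorm_ball_def)
  qed
  then show ?thesis
    by (rule convex_translation)
qed

lemma mem_translate_seminorm_ball:
  "x \<in> (+) x0 ` seminorm_ball \<delta> ps \<longleftrightarrow> max_seminorm ps (x - x0) < \<delta>"
  for x :: "'a::ab_group_add"
  by (force simp: seminorm_ball_def image_iff)

text \<open>Local bounds are chained along the segment from \<open>x1\<close> to \<open>x2\<close>
  by the bisection principle \<open>Bolzano\<close>: the estimate adds up over adjacent subintervals
  and holds on all short ones around a given parameter. Since \<open>P\<close> is finite,
  \<open>max_seminorm P\<close> dominates every local subfamily.\<close>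

lemma lipschitz_near_local_to_global:
  fixes C :: "'a::real_vector set"
  assumes fin: "finite P" and sn: "\<And>p. p \<in> P \<Longrightarrow> seminorm p"
    and "convex C"
    and loc: "\<And>x. x \<in> C \<Longrightarrow> \<exists>\<delta>>0. \<exists>ps. finite_subfamily P ps \<and> lipschitz_near D x \<delta> ps \<phi>"
    and C: "x1 \<in> C" "x2 \<in> C"
  shows "ereal_gap (\<phi> x1) (\<phi> x2) \<le> ereal (max_seminorm P (x1 - x2))"
proof -
  define M where "M = max_seminorm P (x2 - x1)"
  define \<gamma> where "\<gamma> t = x1 + t *\<^sub>R (x2 - x1)" for t :: real
  \<comment> \<open>The estimate between the parameters \<open>s\<close> and \<open>t\<close>; in
    this form chaining is transitivity, even at infinite values.\<close>
  define R where "R s t \<longleftrightarrow> \<phi> (\<gamma> s) \<le> \<phi> (\<gamma> t) + ereal ((t - s) * M) \<and>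
    \<phi> (\<gamma> t) \<le> \<phi> (\<gamma> s) + ereal ((t - s) * M)" for s t
  have "P \<noteq> {}"
    using loc[OF C(1)] unfolding finite_subfamily_def by blast
  then have snP: "seminorm (max_seminorm P)"
    using fin sn by (intro seminorm_max_seminorm) auto
  then have "0 \<le> M"
    unfolding M_def seminorm_def by blast
  have \<gamma>_diff: "\<gamma> t - \<gamma> s = (t - s) *\<^sub>R (x2 - x1)" for s t
    unfolding \<gamma>_def by (simp add: algebra_simps)
  have \<gamma>_dist: "max_seminorm ps (\<gamma> t - \<gamma> s) \<le> \<bar>t - s\<bar> * M" if "finite_subfamily P ps" for ps s t
  proof -
    have "max_seminorm ps (\<gamma> t - \<gamma> s) \<le> max_seminorm P (\<gamma> t - \<gamma> s)"
      using that fin unfolding finite_subfamily_def by (intro max_seminorm_mono) auto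
    also have "\<dots> = \<bar>t - s\<bar> * M"
      using snP unfolding \<gamma>_diff M_def seminorm_def by blast
    finally show ?thesis .
  qed
  have "R 0 1"
  proof (rule Bolzano)
    show "(0::real) \<le> 1" by simp
  next
    fix a b c :: real
    assume R: "R a b" "R b c"
    have trans: "u \<le> w + ereal (r + s)" if "u \<le> v + ereal r" "v \<le> w + ereal s" for u v w r s
      using that by (cases u; cases v; cases w) auto
    have "(b - a) * M + (c - b) * M = (c - a) * M" "(c - b) * M + (b - a) * M = (c - a) * M"
      by (auto simp: algebra_simps)
    with trans[of "\<phi> (\<gamma> a)" "\<phi> (\<gamma> b)" "(b - a) * M" "\<phi> (\<gamma> c)" "(c - b) * M"]
      trans[of "\<phi> (\<gamma> c)" "\<phi> (\<gamma> b)" "(c - b) * M" "\<phi> (\<gamma> a)" "(b - a) * M"]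
    show "R a c"
      using R unfolding R_def by metis
  next
    fix t :: real
    assume t: "0 \<le> t" "t \<le> 1"
    have "\<gamma> t = (1 - t) *\<^sub>R x1 + t *\<^sub>R x2"
      unfolding \<gamma>_def by (simp add: algebra_simps)
    then have "\<gamma> t \<in> C"
      using \<open>convex C\<close> C t by (simp add: convexD)
    then obtain \<delta> ps where \<delta>: "\<delta> > 0" and ps: "finite_subfamily P ps"
      and lip: "lipschitz_near D (\<gamma> t) \<delta> ps \<phi>"
      using loc by blast
    show "\<exists>d>0. \<forall>a b. a \<le> t \<and> t \<le> b \<and> b - a < d \<longrightarrow> R a b"
    \<comment> \<open>\<open>M + 1\<close> instead of \<open>M\<close> allows for
      \<open>M = 0\<close>; the endpoints \<open>\<gamma> a\<close> and \<open>\<gamma> b\<close>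
      then fall into the ball of radius \<open>\<delta>\<close> around
      \<open>\<gamma> t\<close>.\<close>
    proof (intro exI[of _ "\<delta> / (M + 1)"] conjI allI impI)
      show "\<delta> / (M + 1) > 0"
        using \<delta> \<open>0 \<le> M\<close> by simp
      fix a b
      assume ab: "a \<le> t \<and> t \<le> b \<and> b - a < \<delta> / (M + 1)"
      then have "(b - a) * (M + 1) < \<delta>"
        using \<open>0 \<le> M\<close> by (simp add: pos_less_divide_eq)
      then have small: "(b - a) * M < \<delta>"
        using ab by (simp add: algebra_simps)
      have "\<gamma> s \<in> (+) (\<gamma> t) ` seminorm_ball \<delta> ps" if "s \<in> {a, b}" for s
      proof -
        have "max_seminorm ps (\<gamma> s - \<gamma> t) \<le> \<bar>s - t\<bar> * M"
          by (rule \<gamma>_dist[OF ps])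
        also have "\<dots> \<le> (b - a) * M"
          using that ab \<open>0 \<le> M\<close> by (intro mult_right_mono) auto
        finally show ?thesis
          using small unfolding mem_translate_seminorm_ball by simp
      qed
      then have "\<gamma> a \<in> (+) (\<gamma> t) ` seminorm_ball \<delta> ps" "\<gamma> b \<in> (+) (\<gamma> t) ` seminorm_ball \<delta> ps"
        by simp_all
      with lip have "ereal_gap (\<phi> (\<gamma> a)) (\<phi> (\<gamma> b)) \<le> ereal (max_seminorm ps (\<gamma> a - \<gamma> b))"
        unfolding lipschitz_near_def by blast
      also have "max_seminorm ps (\<gamma> a - \<gamma> b) \<le> (b - a) * M"
        using \<gamma>_dist[OF ps, where t = a and s = b] ab by simp
      finally have "ereal_gap (\<phi> (\<gamma> a)) (\<phi> (\<gamma> b)) \<le> ereal ((b - a) * M)"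
        by simp
      moreover have "0 \<le> (b - a) * M"
        using ab \<open>0 \<le> M\<close> by simp
      ultimately show "R a b"
        unfolding R_def by (simp only: ereal_gap_le_iff)
    qed
  qed
  then have "ereal_gap (\<phi> x1) (\<phi> x2) \<le> ereal M"
    unfolding R_def \<gamma>_def ereal_gap_le_iff[OF \<open>0 \<le> M\<close>] by simp
  also have "M = max_seminorm P (x1 - x2)"
    unfolding M_def using seminorm_minus[OF snP, of "x1 - x2"] by simp
  finally show ?thesis .
qed

text \<open>The radius is chosen from \<open>x0\<close> and \<open>interior D\<close> alone, and the
  seminorms are all of \<open>P\<close>, so neither depends on \<open>\<phi>\<close>. As the ball
  lies in \<open>interior D\<close>, each \<open>\<phi>\<close> is Lipschitz near each of its
  points, and convexity of the ball makes the bound hold throughout.\<close>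

lemma equi_locally_lipschitz_of_finite:
  assumes P: "defining_seminorms P" and fin: "finite P"
    and lip: "\<And>\<phi>. \<phi> \<in> \<Phi> \<Longrightarrow> locally_lipschitz P D \<phi>"
  shows "equi_locally_lipschitz P D \<Phi>"
  unfolding equi_locally_lipschitz_def
proof
  fix x0
  assume x0: "x0 \<in> interior D"
  have base: "\<exists>\<delta>>0. \<exists>ps. finite_subfamily P ps \<and> seminorm_ball \<delta> ps \<subseteq> U"
    if "open U" "0 \<in> U" for U
    using conjunct2[OF conjunct2[OF P[unfolded defining_seminorms_def]]] that by simp
  have "open ((\<lambda>v. x0 + v) -` interior D)"
    by (intro open_vimage open_interior continuous_intros)
  moreover have "0 \<in> (\<lambda>v. x0 + v) -` interior D"
    using x0 by simp
  ultimately obtain \<delta> ps where \<delta>: "\<delta> > 0" and ps: "finite_subfamily P ps"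
    and sub: "seminorm_ball \<delta> ps \<subseteq> (\<lambda>v. x0 + v) -` interior D"
    using base[of "(\<lambda>v. x0 + v) -` interior D"] by blast
  have sn: "\<And>p. p \<in> P \<Longrightarrow> seminorm p"
    using conjunct1[OF P[unfolded defining_seminorms_def]] by (rule bspec)
  have "P \<noteq> {}"
    using ps unfolding finite_subfamily_def by blast
  with fin have P_sub: "finite_subfamily P P"
    unfolding finite_subfamily_def by simp
  then have snP: "seminorm (max_seminorm P)"
    using fin \<open>P \<noteq> {}\<close> sn by (intro seminorm_max_seminorm)
  \<comment> \<open>Enlarging the subfamily to all of \<open>P\<close> only shrinks the ball, so it
    stays in \<open>interior D\<close>.\<close>
  have "max_seminorm ps v \<le> max_seminorm P v" for v
    using max_seminorm_mono[OF fin] ps unfolding finite_subfamily_def by blast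
  then have "seminorm_ball \<delta> P \<subseteq> seminorm_ball \<delta> ps"
    unfolding seminorm_ball_def by (meson Collect_mono le_less_trans)
  with sub have ball: "(+) x0 ` seminorm_ball \<delta> P \<subseteq> interior D"
    by auto
  have "lipschitz_near D x0 \<delta> P \<phi>" if "\<phi> \<in> \<Phi>" for \<phi>
    unfolding lipschitz_near_def
  proof (intro conjI ballI)
    show "(+) x0 ` seminorm_ball \<delta> P \<subseteq> D"
      using ball interior_subset by blast
    fix x1 x2
    assume x: "x1 \<in> (+) x0 ` seminorm_ball \<delta> P" "x2 \<in> (+) x0 ` seminorm_ball \<delta> P"
    show "ereal_gap (\<phi> x1) (\<phi> x2) \<le> ereal (max_seminorm P (x1 - x2))"
    proof (rule lipschitz_near_local_to_global[OF fin sn convex_seminorm_ball_translate[OF snP] _ x])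
      fix x
      assume "x \<in> (+) x0 ` seminorm_ball \<delta> P"
      then show "\<exists>\<delta>>0. \<exists>ps. finite_subfamily P ps \<and> lipschitz_near D x \<delta> ps \<phi>"
        using lip[OF that] ball unfolding locally_lipschitz_def by blast
    qed
  qed
  with \<delta> P_sub show "\<exists>\<delta>>0. \<exists>ps. finite_subfamily P ps \<and> (\<forall>\<phi>\<in>\<Phi>. lipschitz_near D x0 \<delta> ps \<phi>)"
    by blast
qed

text \<open>The hypothesis controls the first argument of \<open>e\<close>, whereas the conjugate
  varies with the second; symmetry exchanges them. One neighborhood serving all \<open>x\<close>
  gives the gap bound needed under the supremum.\<close>

lemma locally_lipschitz_e_conj:
  assumes P: "defining_seminorms P" and sym: "\<And>x y. e (x, y) = e (y, x)"
    and equi: "equi_locally_lipschitz P D {\<lambda>z. e (z, x) | x. True}"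
  shows "locally_lipschitz P D (\<lambda>y. e_conj e y f xs)"
  unfolding locally_lipschitz_def
proof
  fix x0
  assume "x0 \<in> interior D"
  then obtain \<delta> ps where \<delta>: "\<delta> > 0" and ps: "finite_subfamily P ps"
    and lip: "\<And>x. lipschitz_near D x0 \<delta> ps (\<lambda>z. e (z, x))"
    using equi unfolding equi_locally_lipschitz_def by blast
  have "seminorm (max_seminorm ps)"
    using conjunct1[OF P[unfolded defining_seminorms_def]] ps unfolding finite_subfamily_def
    by (intro seminorm_max_seminorm) auto
  then have nonneg: "0 \<le> max_seminorm ps v" for v
    unfolding seminorm_def by blast
  have "lipschitz_near D x0 \<delta> ps (\<lambda>y. e_conj e y f xs)"
    unfolding lipschitz_near_def
  proof (intro conjI ballI ereal_gap_e_conj_le nonneg)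
    show "(+) x0 ` seminorm_ball \<delta> ps \<subseteq> D"
      using lip unfolding lipschitz_near_def by blast
    fix y1 y2 x
    assume "y1 \<in> (+) x0 ` seminorm_ball \<delta> ps" "y2 \<in> (+) x0 ` seminorm_ball \<delta> ps"
    with lip[of x] have "ereal_gap (e (y1, x)) (e (y2, x)) \<le> ereal (max_seminorm ps (y1 - y2))"
      unfolding lipschitz_near_def by blast
    then show "ereal_gap (e (x, y1)) (e (x, y2)) \<le> ereal (max_seminorm ps (y1 - y2))"
      unfolding sym[of x] .
  qed
  with \<delta> ps show "\<exists>\<delta>>0. \<exists>ps. finite_subfamily P ps \<and> lipschitz_near D x0 \<delta> ps (\<lambda>y. e_conj e y f xs)"
    by blast
qed

subsection \<open>Subgradients and the biconjugate\<close>

text \<open>Collects what may be assumed in the limit; \<open>\<tau> < 1\<close> makes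
  \<open>\<tau>\<close> admissible as a convexity parameter.\<close>

lemma eventually_cr_filter:
  assumes "\<forall>\<^sub>F y in nhds x. A y" and "\<forall>\<^sub>F \<alpha> in nhds (real_of_ereal (f x)). B \<alpha>"
  shows "\<forall>\<^sub>F (y, \<alpha>, \<tau>) in cr_filter f x. A y \<and> B \<alpha> \<and> 0 < \<tau> \<and> \<tau> < 1 \<and> f y \<le> ereal \<alpha>"
proof -
  have "\<forall>\<^sub>F \<tau> in at_right (0::real). 0 < \<tau> \<and> \<tau> < 1"
    using eventually_at_right_real[of 0 1] by simp
  from eventually_prodI[OF assms(1) eventually_prodI[OF assms(2) this]]
  show ?thesis
    unfolding cr_filter_def eventually_inf_principal
    by (auto elim!: eventually_mono)
qed

lemma cr_derivative_le:
  assumes conv: "e_convex e f" and pos: "\<And>x y. 0 \<le> e (x, y)" and f: "\<And>x. f x \<noteq> -\<infinity>"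
    and sym: "\<And>x y. e (x, y) = e (y, x)"
    and usc: "usc_on (edom f) (\<lambda>y. e (y, z))"
    and x: "x \<in> edom f" and z: "z \<in> edom f"
  shows "cr_derivative f x (z - x) \<le> f z - f x + e (z, x)"
proof -
  obtain a where a: "f x = ereal a"
    using x f[of x] by (cases "f x") (auto simp: edom_def)
  obtain b where b: "f z = ereal b"
    using z f[of z] by (cases "f z") (auto simp: edom_def)
  have fin: "e (u, v) < \<infinity>" if "u \<in> edom f" "v \<in> edom f" for u v
    using conv that unfolding e_convex_def edom_def by auto
  obtain c where c: "e (z, x) = ereal c"
    using fin[OF z x] pos[of z x] by (cases "e (z, x)") auto
  \<comment> \<open>Half of \<open>\<epsilon>\<close> pays for \<open>e (y, z)\<close> exceeding
    \<open>c\<close>, the other half for \<open>\<alpha>\<close> falling below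
    \<open>f x\<close>.\<close>
  have "cr_derivative f x (z - x) \<le> ereal (b - a + c) + ereal \<epsilon>" if "\<epsilon> > 0" for \<epsilon>
    unfolding cr_derivative_def
  proof (rule SUP_least)
    fix U
    assume "U \<in> {U. z - x \<in> interior U}"
    then have U: "z - x \<in> interior U" by simp
    have "((\<lambda>y. z - y) \<longlongrightarrow> z - x) (nhds x)"
      by (intro tendsto_intros filterlim_ident)
    then have "\<forall>\<^sub>F y in nhds x. z - y \<in> interior U"
      using U by (intro topological_tendstoD) auto
    moreover have "\<forall>\<^sub>F y in nhds x. y \<in> edom f \<longrightarrow> e (y, z) < ereal (c + \<epsilon> / 2)"
    proof -
      have "Limsup (at x within edom f) (\<lambda>y. e (y, z)) \<le> e (x, z)"
        using usc x unfolding usc_on_def by blast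
      also have "\<dots> = ereal c"
        using c sym[of x z] by simp
      also have "\<dots> < ereal (c + \<epsilon> / 2)"
        using that by simp
      finally have "\<forall>\<^sub>F y in at x within edom f. e (y, z) < ereal (c + \<epsilon> / 2)"
        by (rule Limsup_lessD)
      \<comment> \<open>The punctured filter says nothing about \<open>y = x\<close>, where the
        error is \<open>c\<close> itself.\<close>
      then show ?thesis
        unfolding eventually_at_filter
        using that c sym[of x z] by (auto elim!: eventually_mono)
    qed
    ultimately have y: "\<forall>\<^sub>F y in nhds x. z - y \<in> interior U \<and> (y \<in> edom f \<longrightarrow> e (y, z) < ereal (c + \<epsilon> / 2))"
      by (rule eventually_conj)
    have \<alpha>: "\<forall>\<^sub>F \<alpha> in nhds (real_of_ereal (f x)). a - \<epsilon> / 2 < \<alpha>"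
      using that a by (intro eventually_nhds_in_open[of "{a - \<epsilon> / 2<..}", simplified]) auto
    show "Limsup (cr_filter f x) (\<lambda>(y, \<alpha>, \<tau>). INF u\<in>U. (f (y + \<tau> *\<^sub>R u) - ereal \<alpha>) / ereal \<tau>)
        \<le> ereal (b - a + c) + ereal \<epsilon>"
    proof (rule Limsup_bounded, rule eventually_mono[OF eventually_cr_filter
          [where A = "\<lambda>y. z - y \<in> interior U \<and> (y \<in> edom f \<longrightarrow> e (y, z) < ereal (c + \<epsilon> / 2))"
            and f = f and x = x and B = "\<lambda>\<alpha>. a - \<epsilon> / 2 < \<alpha>", OF y \<alpha>]], clarify)
      fix y and \<alpha> \<tau> :: real
      assume zy: "z - y \<in> interior U" and e: "y \<in> edom f \<longrightarrow> e (y, z) < ereal (c + \<epsilon> / 2)"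
        and \<alpha>: "a - \<epsilon> / 2 < \<alpha>" and \<tau>: "0 < \<tau>" "\<tau> < 1" and f\<alpha>: "f y \<le> ereal \<alpha>"
      have "y \<in> edom f"
        using f\<alpha> unfolding edom_def by auto
      with e obtain r where "e (y, z) = ereal r" "r < c + \<epsilon> / 2" "0 \<le> r"
        using pos[of y z] by (cases "e (y, z)") auto
      then have r: "e (z, y) = ereal r" "r < c + \<epsilon> / 2" "0 \<le> r"
        by (simp_all add: sym[of z y])
      obtain s where s: "f y = ereal s" "s \<le> \<alpha>"
        using f\<alpha> f[of y] by (cases "f y") auto
      \<comment> \<open>The direction \<open>z - y\<close> moves with \<open>y\<close>, is
        admissible in the infimum for \<open>y\<close> near \<open>x\<close>, and makes the argument
        a convex combination of \<open>z\<close> and \<open>y\<close>.\<close>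
      have "f (y + \<tau> *\<^sub>R (z - y)) = f (\<tau> *\<^sub>R z + (1 - \<tau>) *\<^sub>R y)"
        by (simp add: algebra_simps)
      also have "\<dots> \<le> ereal \<tau> * f z + ereal (1 - \<tau>) * f y + ereal (\<tau> * (1 - \<tau>)) * e (z, y)"
        using conv \<tau> unfolding e_convex_def by simp
      \<comment> \<open>Replacing \<open>f y\<close> by \<open>\<alpha>\<close> and dropping the
        factor \<open>1 - \<tau>\<close> of the nonnegative \<open>r\<close> leaves exactly
        \<open>b - \<alpha> + r\<close> as a bound for the difference quotient.\<close>
      also have "\<dots> \<le> ereal (\<tau> * b + (1 - \<tau>) * \<alpha> + \<tau> * r)"
      proof -
        have "(1 - \<tau>) * s \<le> (1 - \<tau>) * \<alpha>"
          using \<tau> s by (intro mult_left_mono) auto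
        moreover have "\<tau> * (1 - \<tau>) * r \<le> \<tau> * r"
          using \<tau> r by (intro mult_right_mono mult_left_le) auto
        ultimately show ?thesis
          using b r s by simp
      qed
      also have "\<dots> = ereal \<tau> * ereal (b - \<alpha> + r) + ereal \<alpha>"
        by (simp add: algebra_simps)
      finally have "f (y + \<tau> *\<^sub>R (z - y)) \<le> ereal \<tau> * ereal (b - \<alpha> + r) + ereal \<alpha>" .
      then have "(f (y + \<tau> *\<^sub>R (z - y)) - ereal \<alpha>) / ereal \<tau> \<le> ereal (b - \<alpha> + r)"
        using \<tau> by (cases "f (y + \<tau> *\<^sub>R (z - y))") (auto simp: field_simps)
      moreover have "z - y \<in> U"
        using zy interior_subset by blast
      ultimately have "(INF u\<in>U. (f (y + \<tau> *\<^sub>R u) - ereal \<alpha>) / ereal \<tau>) \<le> ereal (b - \<alpha> + r)"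
        by (rule INF_lower2[rotated])
      also have "\<dots> \<le> ereal (b - a + c) + ereal \<epsilon>"
        using r \<alpha> by simp
      finally show "(INF u\<in>U. (f (y + \<tau> *\<^sub>R u) - ereal \<alpha>) / ereal \<tau>) \<le> ereal (b - a + c) + ereal \<epsilon>" .
    qed
  qed
  then have "cr_derivative f x (z - x) \<le> ereal (b - a + c)"
    by (rule ereal_le_epsilon2)
  then show ?thesis
    using a b c by simp
qed

text \<open>A single subgradient suffices: it gives an upper bound for the conjugate at
  \<open>xs\<close>, and \<open>xs\<close> is one competitor in the supremum defining the
  biconjugate. If \<open>e (x, y)\<close> is infinite, the left side is minus infinity.\<close>

lemma e_biconj_ge:
  assumes conv: "e_convex e f" and pos: "\<And>x y. 0 \<le> e (x, y)" and f: "\<And>x. f x \<noteq> -\<infinity>"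
    and sym: "\<And>x y. e (x, y) = e (y, x)"
    and usc: "\<And>w. w \<in> edom f \<Longrightarrow> usc_on (edom f) (\<lambda>z. e (z, w))"
    and tri: "triangle_inequality e"
    and x: "x \<in> edom f" and xs: "xs \<in> cr_subdifferential f x"
  shows "f x - e (x, y) \<le> e_biconj e y f x"
proof (cases "e (x, y)")
  case (real d)
  obtain a where a: "f x = ereal a"
    using x f[of x] by (cases "f x") (auto simp: edom_def)
  have "linear xs" and "xs \<in> dual"
    using xs unfolding cr_subdifferential_def dual_def by auto
  have "e_conj e y f xs \<le> ereal (xs x - a + d)"
    unfolding e_conj_def
  proof (rule SUP_least)
    fix z
    show "ereal (xs z) - f z - e (z, y) \<le> ereal (xs x - a + d)"
    proof (cases "z \<in> edom f")
      case True
      have "ereal (xs (z - x)) \<le> cr_derivative f x (z - x)"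
        using xs unfolding cr_subdifferential_def by blast
      \<comment> \<open>Semicontinuity is applied with \<open>z\<close>, not \<open>x\<close>, as
        the fixed argument of the error.\<close>
      also have "\<dots> \<le> f z - f x + e (z, x)"
        by (rule cr_derivative_le[OF conv pos f sym usc[OF True] x True])
      finally have "ereal (xs z - xs x) \<le> f z - f x + e (z, x)"
        using linear_diff[OF \<open>linear xs\<close>] by simp
      moreover have "e (z, x) \<le> e (z, y) + e (y, x)"
        using tri unfolding triangle_inequality_def by blast
      \<comment> \<open>For finite \<open>e (z, y)\<close> this term cancels and
        \<open>e (y, x) = d\<close> remains; if it is infinite, the left side is minus
        infinity.\<close>
      ultimately show ?thesis
        using f[of z] a real sym[of y x] pos[of z y] pos[of z x]
        by (cases "f z"; cases "e (z, y)"; cases "e (z, x)") auto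
    next
      case False
      then show ?thesis
        using pos[of z y] by (cases "e (z, y)") (auto simp: edom_def)
    qed
  qed
  then have "f x - e (x, y) \<le> ereal (xs x) - e_conj e y f xs"
    using a real by (cases "e_conj e y f xs") auto
  also have "\<dots> \<le> e_biconj e y f x"
    unfolding e_biconj_def using \<open>xs \<in> dual\<close> by (rule SUP_upper)
  finally show ?thesis .
next
  case PInf
  then show ?thesis
    using x by (cases "f x") (auto simp: edom_def)
next
  case MInf
  then show ?thesis
    using pos[of x y] by simp
qed

theorem proposition10:
  fixes e :: "'a::hausdorff_lcs \<times> 'a \<Rightarrow> ereal" and f g :: "'a \<Rightarrow> ereal"
  assumes "error_function e"
    and "\<forall>x. f x \<noteq> -\<infinity>" and "\<forall>x. g x \<noteq> -\<infinity>"
    and "e_convex e f" and "e_convex e g"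
    and "edom f \<inter> edom g \<noteq> {}"
  shows "
     (\<forall>y. (\<forall>xs\<in>dual. e_conj e y f xs \<le> fenchel_conj f xs) \<and>
       (proper_on dual (fenchel_conj f) \<longrightarrow> proper_on dual (e_conj e y f))) \<and>

     ((\<forall>x. f x \<le> g x) \<longrightarrow> (\<forall>y. \<forall>xs\<in>dual. e_conj e y g xs \<le> e_conj e y f xs)) \<and>

     (\<forall>e' y. error_function e' \<and> (\<forall>x. e (x, y) \<le> e' (x, y)) \<longrightarrow>
       (\<forall>xs\<in>dual. e_conj e' y f xs \<le> e_conj e y f xs)) \<and>

     (\<forall>l::real. \<forall>y. \<forall>xs\<in>dual.
       e_conj e y (\<lambda>x. f x + ereal l) xs = e_conj e y f xs - ereal l) \<and>

     (\<forall>l>0. \<forall>y. \<forall>xs\<in>dual.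
       e_conj e y (\<lambda>x. ereal l * f x) xs
         = ereal l * e_conj (\<lambda>p. e p / ereal l) y f (\<lambda>x. xs x / l)) \<and>

     (\<forall>l>0. \<forall>k>0. pos_homogeneous k e \<longrightarrow>
       (\<forall>y. \<forall>xs\<in>dual.
          e_conj e y (\<lambda>x. f (l *\<^sub>R x)) xs
            = e_conj (\<lambda>p. e p / ereal (l powr k)) (l *\<^sub>R y) f (\<lambda>x. xs x / l))) \<and>

     (\<forall>P. defining_seminorms P \<and>
         ((finite P \<and> (\<forall>x. locally_lipschitz P (edom f) (\<lambda>z. e (z, x)))) \<or>
          equi_locally_lipschitz P (edom f) {\<lambda>z. e (z, x) | x. True}) \<longrightarrow>
       (\<forall>xs\<in>dual. locally_lipschitz P (edom f) (\<lambda>y. e_conj e y f xs))) \<and>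

     (\<forall>l\<in>{0<..<1}. \<forall>y. \<forall>xs\<in>dual.
       e_conj e y (\<lambda>x. ereal l * f x + ereal (1 - l) * g x) xs
         \<le> lower_add (ereal l * e_conj e y f xs) (ereal (1 - l) * e_conj e y g xs)) \<and>

     (\<forall>x y. e_biconj e y f x \<le> f x + e (x, y)) \<and>

     ((\<forall>w\<in>edom f. usc_on (edom f) (\<lambda>z. e (z, w))) \<and> triangle_inequality e \<longrightarrow>
       (\<forall>y. \<forall>x\<in>edom f. cr_subdifferential f x \<noteq> {} \<longrightarrow>
          f x - e (x, y) \<le> e_biconj e y f x))"
proof (intro conjI)
  have pos: "\<And>x y. 0 \<le> e (x, y)" and sym: "\<And>x y. e (x, y) = e (y, x)"
    using assms(1) unfolding error_function_def by auto
  have f: "\<And>x. f x \<noteq> -\<infinity>" and g: "\<And>x. g x \<noteq> -\<infinity>"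
    using assms(2,3) by auto
  have le: "e_conj e y f xs \<le> fenchel_conj f xs" for y xs
    unfolding e_conj_zero[of y, symmetric] by (intro e_conj_mono order_refl pos)
  then have "proper_on dual (e_conj e y f)" if "proper_on dual (fenchel_conj f)" for y
    \<comment> \<open>The same functional witnesses properness of both conjugates.\<close>
    using that le_less_trans[OF le] unfolding proper_on_def edom_def by blast
  with le show "\<forall>y. (\<forall>xs\<in>dual. e_conj e y f xs \<le> fenchel_conj f xs) \<and>
      (proper_on dual (fenchel_conj f) \<longrightarrow> proper_on dual (e_conj e y f))"
    by blast
  show "(\<forall>x. f x \<le> g x) \<longrightarrow> (\<forall>y. \<forall>xs\<in>dual. e_conj e y g xs \<le> e_conj e y f xs)"
    by (auto intro: e_conj_mono)
  show "\<forall>e' y. error_function e' \<and> (\<forall>x. e (x, y) \<le> e' (x, y)) \<longrightarrow>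
      (\<forall>xs\<in>dual. e_conj e' y f xs \<le> e_conj e y f xs)"
    by (auto intro: e_conj_mono)
  show "\<forall>l::real. \<forall>y. \<forall>xs\<in>dual.
      e_conj e y (\<lambda>x. f x + ereal l) xs = e_conj e y f xs - ereal l"
    by (simp add: e_conj_add_const)
  show "\<forall>l>0. \<forall>y. \<forall>xs\<in>dual. e_conj e y (\<lambda>x. ereal l * f x) xs
      = ereal l * e_conj (\<lambda>p. e p / ereal l) y f (\<lambda>x. xs x / l)"
    by (intro allI impI ballI e_conj_scale)
  show "\<forall>l>0. \<forall>k>0. pos_homogeneous k e \<longrightarrow>
      (\<forall>y. \<forall>xs\<in>dual. e_conj e y (\<lambda>x. f (l *\<^sub>R x)) xs
        = e_conj (\<lambda>p. e p / ereal (l powr k)) (l *\<^sub>R y) f (\<lambda>x. xs x / l))"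
    by (intro allI impI ballI e_conj_dilate) (auto simp: dual_def)
  show "\<forall>P. defining_seminorms P \<and>
      ((finite P \<and> (\<forall>x. locally_lipschitz P (edom f) (\<lambda>z. e (z, x)))) \<or>
       equi_locally_lipschitz P (edom f) {\<lambda>z. e (z, x) | x. True}) \<longrightarrow>
      (\<forall>xs\<in>dual. locally_lipschitz P (edom f) (\<lambda>y. e_conj e y f xs))"
  proof (intro allI impI ballI)
    fix P xs
    assume *: "defining_seminorms P \<and>
      ((finite P \<and> (\<forall>x. locally_lipschitz P (edom f) (\<lambda>z. e (z, x)))) \<or>
       equi_locally_lipschitz P (edom f) {\<lambda>z. e (z, x) | x. True})"
    then have P: "defining_seminorms P" ..
    \<comment> \<open>Both alternatives reduce to a neighborhood common to all \<open>x\<close>;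
      only the finite family requires an argument.\<close>
    from * have "equi_locally_lipschitz P (edom f) {\<lambda>z. e (z, x) | x. True}"
    proof (elim conjE disjE)
      assume "finite P" and "\<forall>x. locally_lipschitz P (edom f) (\<lambda>z. e (z, x))"
      then show ?thesis
        using P by (intro equi_locally_lipschitz_of_finite) auto
    qed
    then show "locally_lipschitz P (edom f) (\<lambda>y. e_conj e y f xs)"
      by (rule locally_lipschitz_e_conj[where e = e, OF P sym])
  qed
  show "\<forall>l\<in>{0<..<1}. \<forall>y. \<forall>xs\<in>dual.
      e_conj e y (\<lambda>x. ereal l * f x + ereal (1 - l) * g x) xs
        \<le> lower_add (ereal l * e_conj e y f xs) (ereal (1 - l) * e_conj e y g xs)"
    by (intro ballI allI e_conj_convex f g pos)
  show "\<forall>x y. e_biconj e y f x \<le> f x + e (x, y)"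
    by (intro allI e_biconj_le f pos)
  show "(\<forall>w\<in>edom f. usc_on (edom f) (\<lambda>z. e (z, w))) \<and> triangle_inequality e \<longrightarrow>
      (\<forall>y. \<forall>x\<in>edom f. cr_subdifferential f x \<noteq> {} \<longrightarrow> f x - e (x, y) \<le> e_biconj e y f x)"
  proof (intro impI allI ballI)
    fix y x
    assume "(\<forall>w\<in>edom f. usc_on (edom f) (\<lambda>z. e (z, w))) \<and> triangle_inequality e"
      and x: "x \<in> edom f" and "cr_subdifferential f x \<noteq> {}"
    then obtain xs where usc: "\<And>w. w \<in> edom f \<Longrightarrow> usc_on (edom f) (\<lambda>z. e (z, w))"
      and tri: "triangle_inequality e" and xs: "xs \<in> cr_subdifferential f x"
      by blast
    show "f x - e (x, y) \<le> e_biconj e y f x"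
      by (rule e_biconj_ge[OF assms(4) pos f sym usc tri x xs])
  qed
qed

end
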